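(* Let $\Sigma$ be an alphabet with $|\Sigma|\geq2$ and let $k_1,k_2$ be integers. Then there exists a polynomial-time reduction from the promise problem of deciding whether a given graph $G$ satisfies $\chi(G)\leq b(k_1)$ or $\chi(G)\geq k_2$ to the problem $\mathrm{IC}_\Sigma(k_1,\log_{|\Sigma|}\log k_2)$.
   Context: $b(n)=\binom{n}{\lfloor n/2\rfloor}$; logarithms are base 2 unless a base is indicated; $\chi$ is the chromatic number. For a graph $G$ on vertex set $[n]$ and a finite alphabet $\Sigma$, an index code for $G$ over $\Sigma$ of length $k$ is a function $E:\Sigma^n\to\Sigma^k$ such that for every $i\in[n]$ there is $g_i:\Sigma^{k+|N_G(i)|}\to\Sigma$ with $g_i(E(x),x|_{N_G(i)})=x_i$ for all $x\in\Sigma^n$, where $N_G(i)$ is the neighborhood of $i$ and $x|_{N_G(i)}$ the restriction of $x$ to those coordinates. $\mathrm{IC}_\Sigma(a,c)$ is the promise problem of deciding whether the minimal length of an index code for a given graph over $\Sigma$ is at most $a$ or at least $c$. A reduction between promise problems maps instances of the first kind (YES) to YES instances and instances of the second kind (NO) to NO instances. *)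

theory Defs
  imports Complex_Main "HOL-Library.FuncSet" "HOL-Library.NList"
    "HOL-Computational_Algebra.Polynomial"
begin

section \<open>Graphs, colourings and index codes\<close>

text \<open>A finite simple graph is a pair (n, E) with vertex set \<open>{0..<n}\<close> (instead of
  \<open>{1..n}\<close>, to match list indices) and a set E of two-element edges. The graph without vertices
  is admitted.\<close>

type_synonym graph = "nat \<times> nat set set"

abbreviation order :: "graph \<Rightarrow> nat" where "order \<equiv> fst"
abbreviation edges :: "graph \<Rightarrow> nat set set" where "edges \<equiv> snd"

definition is_graph :: "graph \<Rightarrow> bool" where
  "is_graph G \<longleftrightarrow> (\<forall>e\<in>edges G. e \<subseteq> {0..<order G} \<and> card e = 2)"

definition nbhd :: "graph \<Rightarrow> nat \<Rightarrow> nat set" where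
  "nbhd G i = {j. {i, j} \<in> edges G}"

definition proper_colouring :: "graph \<Rightarrow> nat \<Rightarrow> (nat \<Rightarrow> nat) \<Rightarrow> bool" where
  "proper_colouring G k c \<longleftrightarrow>
     c \<in> {0..<order G} \<rightarrow> {0..<k} \<and> (\<forall>i j. {i, j} \<in> edges G \<longrightarrow> c i \<noteq> c j)"

definition chromatic_number :: "graph \<Rightarrow> nat" where
  "chromatic_number G = (LEAST k. \<exists>c. proper_colouring G k c)"

definition mid_binom :: "nat \<Rightarrow> nat" where
  "mid_binom n = n choose (n div 2)"

text \<open>\<open>nlists n \<Sigma>\<close> is the set of words of length n over \<open>\<Sigma>\<close>, and \<open>nths x N\<close> is the restriction of
  the word x to the positions in N, in increasing order.\<close>

definition index_code :: "'a set \<Rightarrow> graph \<Rightarrow> nat \<Rightarrow> ('a list \<Rightarrow> 'a list) \<Rightarrow> bool" where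
  "index_code \<Sigma> G k E \<longleftrightarrow>
     E \<in> nlists (order G) \<Sigma> \<rightarrow> nlists k \<Sigma> \<and>
     (\<forall>i<order G. \<exists>g \<in> nlists (k + card (nbhd G i)) \<Sigma> \<rightarrow> \<Sigma>.
        \<forall>x \<in> nlists (order G) \<Sigma>. g (E x @ nths x (nbhd G i)) = x ! i)"

definition min_index_code_length :: "'a set \<Rightarrow> graph \<Rightarrow> nat" where
  "min_index_code_length \<Sigma> G = (LEAST k. \<exists>E. index_code \<Sigma> G k E)"

section \<open>Polynomial-time computation\<close>

text \<open>Deterministic multi-tape Turing machines with two-way infinite tapes. Tape symbols are the
  numbers below \<open>num_syms\<close>, with 0 the blank and 1, 2 the two bits; states are the
  numbers below \<open>num_states\<close>, with 0 initial, and \<open>num_states\<close> itself is the halting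
  state. Tapes are stored relative to the head: cell 0 is always the scanned one, and moving the
  head shifts the contents. The transition function matters only on the finitely many arguments
  constrained by \<open>tm_wf\<close>.\<close>

datatype move = Move_Left | Stay | Move_Right

type_synonym tape = "int \<Rightarrow> nat"
type_synonym config = "nat \<times> tape list"

record tm =
  num_tapes :: nat
  num_states :: nat
  num_syms :: nat
  delta :: "nat \<Rightarrow> nat list \<Rightarrow> nat \<times> (nat \<times> move) list"

definition tm_wf :: "tm \<Rightarrow> bool" where
  "tm_wf M \<longleftrightarrow> 2 \<le> num_tapes M \<and> 3 \<le> num_syms M \<and>
     (\<forall>q ss. q < num_states M \<longrightarrow> ss \<in> nlists (num_tapes M) {0..<num_syms M} \<longrightarrow>
        fst (delta M q ss) \<le> num_states M \<and>
        snd (delta M q ss) \<in> nlists (num_tapes M) ({0..<num_syms M} \<times> UNIV))"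

fun shift :: "move \<Rightarrow> tape \<Rightarrow> tape" where
  "shift Move_Left t = (\<lambda>i. t (i - 1))"
| "shift Stay t = t"
| "shift Move_Right t = (\<lambda>i. t (i + 1))"

definition act :: "nat \<times> move \<Rightarrow> tape \<Rightarrow> tape" where
  "act a t = shift (snd a) (t(0 := fst a))"

definition step :: "tm \<Rightarrow> config \<Rightarrow> config" where
  "step M c =
     (if fst c < num_states M
      then let r = delta M (fst c) (map (\<lambda>t. t 0) (snd c))
           in (fst r, map2 act (snd r) (snd c))
      else c)"

definition word_tape :: "bool list \<Rightarrow> tape" where
  "word_tape w = (\<lambda>i. if 0 \<le> i \<and> i < int (length w) then (if w ! nat i then 2 else 1) else 0)"

definition init_config :: "tm \<Rightarrow> bool list \<Rightarrow> config" where
  "init_config M w = (0, word_tape w # replicate (num_tapes M - 1) (word_tape []))"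

text \<open>The input is on the first tape; the output is read off the second tape, which on halting must
  contain nothing else and have its head on the first output bit.\<close>

definition computes_within :: "tm \<Rightarrow> bool list \<Rightarrow> bool list \<Rightarrow> nat \<Rightarrow> bool" where
  "computes_within M w v T \<longleftrightarrow>
     (\<exists>t\<le>T. \<exists>ts. (step M ^^ t) (init_config M w) = (num_states M, ts) \<and> ts ! 1 = word_tape v)"

text \<open>The order in unary, a separator, and the adjacency matrix row by row.\<close>

definition encode_graph :: "graph \<Rightarrow> bool list" where
  "encode_graph G = replicate (order G) True @ [False] @
     concat (map (\<lambda>i. map (\<lambda>j. {i, j} \<in> edges G) [0..<order G]) [0..<order G])"

definition poly_time_graph_map :: "(graph \<Rightarrow> graph) \<Rightarrow> bool" where
  "poly_time_graph_map f \<longleftrightarrow>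
     (\<forall>G. is_graph G \<longrightarrow> is_graph (f G)) \<and>
     (\<exists>M (p :: nat poly). tm_wf M \<and>
        (\<forall>G. is_graph G \<longrightarrow>
           computes_within M (encode_graph G) (encode_graph (f G))
             (poly p (length (encode_graph G)))))"

section \<open>Promise problems on graphs\<close>

text \<open>The YES instances and the NO instances. Disjointness is not imposed.\<close>

type_synonym promise_problem = "graph set \<times> graph set"

definition poly_time_reducible :: "promise_problem \<Rightarrow> promise_problem \<Rightarrow> bool" where
  "poly_time_reducible P Q \<longleftrightarrow>
     (\<exists>f. poly_time_graph_map f \<and>
        (\<forall>G\<in>fst P. f G \<in> fst Q) \<and> (\<forall>G\<in>snd P. f G \<in> snd Q))"

definition chromatic_problem :: "nat \<Rightarrow> nat \<Rightarrow> promise_problem" where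
  "chromatic_problem a c =
     ({G. is_graph G \<and> chromatic_number G \<le> a}, {G. is_graph G \<and> c \<le> chromatic_number G})"

definition IC :: "'a set \<Rightarrow> real \<Rightarrow> real \<Rightarrow> promise_problem" where
  "IC \<Sigma> a c =
     ({G. is_graph G \<and> real (min_index_code_length \<Sigma> G) \<le> a},
      {G. is_graph G \<and> c \<le> real (min_index_code_length \<Sigma> G)})"

end

theory Submission
  imports Defs "HOL-Number_Theory.Cong"
begin

text \<open>The reduction sends G to the complement of its line digraph: the vertices are the arcs (u, v) of
  G, and two of them are adjacent unless one starts where the other ends. If G is coloured by the
  b(k)-many middle-layer subsets of a k-set, colouring an arc (u, v) by an element of the set of u
  that is not in the set of v covers the arc graph by k cliques, and sending the sum modulo
  \<open>|\<Sigma>|\<close> over each clique is an index code of length k. Conversely, given an index code E of length k,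
  colour a vertex v of G by the set of all codewords E(x) with x supported on the arcs leaving v.
  The receiver (u, v) does not know the arcs leaving v, so the codeword of the word supported on
  (u, v) alone tells u and v apart; hence \<open>\<chi>(G) \<le> 2 ^ (|\<Sigma>| ^ k)\<close>.\<close>

(* As simp rules these send the simplifier into loops below. *)
declare nlistsE_length [simp del] nlistsE_set [simp del]

section \<open>The arc graph and its index codes\<close>

text \<open>This is the order in which a row-by-row scan meets the ones of the adjacency matrix, so
  scanning the matrix enumerates the vertices of the new graph.\<close>

definition arcs :: "graph \<Rightarrow> (nat \<times> nat) list" where
  "arcs G = filter (\<lambda>(i,j). {i,j} \<in> edges G) (List.product [0..<order G] [0..<order G])"

definition consecutive :: "nat \<times> nat \<Rightarrow> nat \<times> nat \<Rightarrow> bool" where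
  "consecutive e f \<longleftrightarrow> snd e = fst f \<or> snd f = fst e"

definition arc_graph :: "graph \<Rightarrow> graph" where
  "arc_graph G = (length (arcs G),
     {{a, b} |a b. a < length (arcs G) \<and> b < length (arcs G) \<and> a \<noteq> b \<and>
        \<not> consecutive (arcs G ! a) (arcs G ! b)})"

lemma is_graph_edgeD:
  assumes "is_graph G" "{i, j} \<in> edges G"
  shows "i < order G" "j < order G" "i \<noteq> j"
  using assms unfolding is_graph_def by fastforce+

lemma distinct_arcs: "distinct (arcs G)"
  by (simp add: arcs_def distinct_product)

lemma set_arcs: "is_graph G \<Longrightarrow> set (arcs G) = {(i, j). {i, j} \<in> edges G}"
  by (auto simp: arcs_def dest: is_graph_edgeD)

lemma is_graph_arc_graph: "is_graph (arc_graph G)"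
  by (auto simp: is_graph_def arc_graph_def)

lemma order_arc_graph [simp]: "order (arc_graph G) = length (arcs G)"
  by (simp add: arc_graph_def)

text \<open>The set \<open>{a, b}\<close> also arises from the pair (b, a); both descriptions agree
  because \<open>consecutive\<close> is symmetric.\<close>

lemma edges_arc_graph_iff:
  "{a, b} \<in> edges (arc_graph G) \<longleftrightarrow> a < length (arcs G) \<and> b < length (arcs G) \<and> a \<noteq> b \<and>
     \<not> consecutive (arcs G ! a) (arcs G ! b)"
  by (auto simp: arc_graph_def doubleton_eq_iff consecutive_def)

section \<open>Index codes without explicit decoders\<close>

lemma nths_eq_map: "nths x S = map ((!) x) (filter (\<lambda>i. i \<in> S) [0..<length x])"
proof -
  have *: "zip x [0..<length x] = map (\<lambda>i. (x ! i, i)) [0..<length x]"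
    by (rule nth_equalityI) auto
  show ?thesis
    unfolding nths_def * by (simp add: filter_map o_def)
qed

lemma nths_eq_iff:
  assumes "length x = length y"
  shows "nths x S = nths y S \<longleftrightarrow> (\<forall>i\<in>S. i < length x \<longrightarrow> x ! i = y ! i)"
  using assms by (auto simp: nths_eq_map)

text \<open>Once codeword and side information determine the wanted symbol, a decoder can look up
  any word that produces the received data.\<close>

lemma index_code_iff:
  assumes "is_graph G" "\<Sigma> \<noteq> {}"
  shows "index_code \<Sigma> G k E \<longleftrightarrow>
    E \<in> nlists (order G) \<Sigma> \<rightarrow> nlists k \<Sigma> \<and>
    (\<forall>i<order G. \<forall>x\<in>nlists (order G) \<Sigma>. \<forall>y\<in>nlists (order G) \<Sigma>.
       E x = E y \<and> (\<forall>j\<in>nbhd G i. x ! j = y ! j) \<longrightarrow> x ! i = y ! i)" (is "?L \<longleftrightarrow> ?E \<and> ?R")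
proof
  assume L: ?L
  have ?R
  proof (intro allI ballI impI)
    fix i x y
    assume i: "i < order G" and x: "x \<in> nlists (order G) \<Sigma>" and y: "y \<in> nlists (order G) \<Sigma>"
      and eq: "E x = E y \<and> (\<forall>j\<in>nbhd G i. x ! j = y ! j)"
    from L i obtain g where g: "\<forall>x \<in> nlists (order G) \<Sigma>. g (E x @ nths x (nbhd G i)) = x ! i"
      using L[unfolded index_code_def, THEN conjunct2, rule_format, OF i] by blast
    have "nths x (nbhd G i) = nths y (nbhd G i)"
      using eq nths_eq_iff[of x y] nlistsE_length[OF x] nlistsE_length[OF y] by simp
    moreover have "g (E x @ nths x (nbhd G i)) = x ! i" "g (E y @ nths y (nbhd G i)) = y ! i"
      by (rule bspec[OF g x], rule bspec[OF g y])
    ultimately show "x ! i = y ! i"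
      using eq by simp
  qed
  moreover have ?E
    using L unfolding index_code_def by (rule conjunct1)
  ultimately show "?E \<and> ?R" by (intro conjI)
next
  assume R: "?E \<and> ?R"
  have ty: "E x \<in> nlists k \<Sigma>" if "x \<in> nlists (order G) \<Sigma>" for x
    using that by (rule Pi_mem[OF conjunct1[OF R]])
  have dec: "x ! i = y ! i"
    if "i < order G" "x \<in> nlists (order G) \<Sigma>" "y \<in> nlists (order G) \<Sigma>" "E x = E y"
      "\<And>j. j \<in> nbhd G i \<Longrightarrow> x ! j = y ! j" for i x y
    using conjunct2[OF R, rule_format] that by blast
  obtain z where z: "z \<in> \<Sigma>" using assms(2) by blast
  have "\<exists>g \<in> nlists (k + card (nbhd G i)) \<Sigma> \<rightarrow> \<Sigma>.
        \<forall>x \<in> nlists (order G) \<Sigma>. g (E x @ nths x (nbhd G i)) = x ! i" if i: "i < order G" for i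
  proof -
    define Q where "Q w x \<longleftrightarrow> x \<in> nlists (order G) \<Sigma> \<and> E x @ nths x (nbhd G i) = w" for w x
    \<comment> \<open>The default \<open>z\<close> keeps the values inside \<Sigma> on received
      words that no x produces.\<close>
    define g where "g w = (if \<exists>x. Q w x then (SOME x. Q w x) ! i else z)" for w
    have uniq: "x ! i = y ! i" if "Q w x" "Q w y" for w x y
    proof -
      have x: "x \<in> nlists (order G) \<Sigma>" and y: "y \<in> nlists (order G) \<Sigma>"
        and e: "E x @ nths x (nbhd G i) = E y @ nths y (nbhd G i)"
        using that by (auto simp: Q_def)
      \<comment> \<open>All codewords have length k, so a received word splits uniquely into
        codeword and side information.\<close>
      have "length (E x) = length (E y)"
        using nlistsE_length[OF ty[OF x]] nlistsE_length[OF ty[OF y]] by simp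
      with e have e': "E x = E y" "nths x (nbhd G i) = nths y (nbhd G i)"
        by simp_all
      have "x ! j = y ! j" if "j \<in> nbhd G i" for j
      proof -
        \<comment> \<open>\<open>nths\<close> ignores positions beyond the end of the word, so j
          must be in range before the symbols at j can be compared.\<close>
        have "j < order G" using that is_graph_edgeD(2)[OF assms(1), of i j] by (simp add: nbhd_def)
        then show ?thesis
          using e'(2) that nths_eq_iff[of x y "nbhd G i"] nlistsE_length[OF x] nlistsE_length[OF y]
          by simp
      qed
      then show ?thesis by (rule dec[OF i x y e'(1)])
    qed
    have g_in: "g w \<in> \<Sigma>" for w
    proof (cases "\<exists>x. Q w x")
      case True
      then have "Q w (SOME x. Q w x)" by (rule someI_ex)
      then have "(SOME x. Q w x) \<in> nlists (order G) \<Sigma>" by (simp only: Q_def)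
      then show ?thesis using True nlistsE_nth_in[OF _ i] by (simp add: g_def)
    qed (use z in \<open>simp add: g_def\<close>)
    have g_dec: "g (E x @ nths x (nbhd G i)) = x ! i" if "x \<in> nlists (order G) \<Sigma>" for x
    proof -
      have q: "Q (E x @ nths x (nbhd G i)) x" using that by (simp add: Q_def)
      then have "(SOME y. Q (E x @ nths x (nbhd G i)) y) ! i = x ! i"
        by (intro uniq[OF _ q]) (rule someI)
      with q show ?thesis unfolding g_def by auto
    qed
    show ?thesis by (intro bexI[of _ g] ballI Pi_I g_dec g_in)
  qed
  then show ?L unfolding index_code_def by (intro conjI conjunct1[OF R] allI impI)
qed

lemma chromatic_number_colouring:
  assumes "is_graph G"
  obtains c where "proper_colouring G (chromatic_number G) c"
proof -
  \<comment> \<open>Giving every vertex its own colour shows that the least number of colours is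
    attained.\<close>
  have "proper_colouring G (order G) (\<lambda>i. i)"
    using is_graph_edgeD[OF assms] by (auto simp: proper_colouring_def)
  then have "\<exists>c. proper_colouring G (chromatic_number G) c"
    unfolding chromatic_number_def by (intro LeastI_ex[of "\<lambda>k. \<exists>c. proper_colouring G k c"] exI)
  then show thesis using that by blast
qed

lemma min_index_code:
  assumes "is_graph G" "\<Sigma> \<noteq> {}"
  obtains E where "index_code \<Sigma> G (min_index_code_length \<Sigma> G) E"
proof -
  \<comment> \<open>Sending the whole word shows that the minimal length is attained.\<close>
  have "index_code \<Sigma> G (order G) (\<lambda>x. x)"
    using assms by (auto simp: index_code_iff)
  then have "\<exists>E. index_code \<Sigma> G (min_index_code_length \<Sigma> G) E"
    unfolding min_index_code_length_def by (intro LeastI_ex[of "\<lambda>k. \<exists>E. index_code \<Sigma> G k E"] exI)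
  then show thesis using that by blast
qed

section \<open>From an index code of the arc graph to a colouring\<close>

lemma card_nlists: "finite A \<Longrightarrow> card (nlists k A) = card A ^ k"
  using card_lists_length_eq[of A k] by (simp add: nlists_def conj_commute)

lemma finite_nlists: "finite A \<Longrightarrow> finite (nlists k A)"
  using finite_lists_length_eq[of A k] by (simp add: nlists_def conj_commute)

lemma chromatic_number_le_index_code:
  assumes G: "is_graph G" and fin: "finite \<Sigma>" and two: "card \<Sigma> \<ge> 2"
    and E: "index_code \<Sigma> (arc_graph G) k E"
  shows "chromatic_number G \<le> 2 ^ (card \<Sigma> ^ k)"
proof -
  let ?N = "length (arcs G)"
  obtain z0 z1 where z: "z0 \<in> \<Sigma>" "z1 \<in> \<Sigma>" "z0 \<noteq> z1"
    using two fin by (metis One_nat_def Suc_1 card_le_Suc0_iff_eq not_less_eq_eq)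
  then have "\<Sigma> \<noteq> {}" by blast
  note E = E[unfolded index_code_iff[OF is_graph_arc_graph this] order_arc_graph]
  \<comment> \<open>The symbol \<open>z0\<close> acts as zero: a word is supported on the arcs
    leaving v if it is \<open>z0\<close> everywhere else.\<close>
  define S where "S v = E ` {x \<in> nlists ?N \<Sigma>. \<forall>a<?N. fst (arcs G ! a) \<noteq> v \<longrightarrow> x ! a = z0}" for v
  have "S v \<in> Pow (nlists k \<Sigma>)" for v
    using E unfolding S_def by auto
  have fin': "finite (Pow (nlists k \<Sigma>))" using fin by (simp add: finite_nlists)
  have card: "card (Pow (nlists k \<Sigma>)) = 2 ^ (card \<Sigma> ^ k)"
    using fin by (simp add: card_Pow finite_nlists card_nlists)
  obtain h where h: "bij_betw h (Pow (nlists k \<Sigma>)) {0..<(2::nat) ^ (card \<Sigma> ^ k)}"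
    using ex_bij_betw_finite_nat[OF fin'] card by auto
  have neq: "S u \<noteq> S v" if uv: "{u, v} \<in> edges G" for u v
  proof
    assume "S u = S v"
    have "(u, v) \<in> set (arcs G)" using G uv by (simp add: set_arcs)
    then obtain a where a: "a < ?N" "arcs G ! a = (u, v)" by (metis in_set_conv_nth)
    have "u \<noteq> v" using is_graph_edgeD[OF G uv] by simp
    define x where "x = (replicate ?N z0)[a := z1]"
    have x: "x \<in> nlists ?N \<Sigma>" unfolding x_def
      using z by (intro nlists_update_in_list nlistsI) auto
    have xb: "x ! b = (if b = a then z1 else z0)" if "b < ?N" for b
      using that by (simp add: x_def nth_list_update)
    have "E x \<in> S u" unfolding S_def using x xb a by auto
    then obtain y where y: "y \<in> nlists ?N \<Sigma>" "E x = E y"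
      "\<forall>b<?N. fst (arcs G ! b) \<noteq> v \<longrightarrow> y ! b = z0"
      using \<open>S u = S v\<close> unfolding S_def by auto
    \<comment> \<open>An arc adjacent to (u, v) does not start at v, so x and y both carry
      \<open>z0\<close> there. The receiver (u, v) therefore cannot tell x from y, although they
      differ at its own position.\<close>
    have "x ! b = y ! b" if "b \<in> nbhd (arc_graph G) a" for b
    proof -
      have b: "b < ?N" "b \<noteq> a" "fst (arcs G ! b) \<noteq> v"
        using that a by (auto simp: nbhd_def edges_arc_graph_iff consecutive_def)
      then show ?thesis using y xb by simp
    qed
    then have "x ! a = y ! a" using E a(1) x y(1,2) by blast
    moreover have "y ! a = z0" using y(3) a \<open>u \<noteq> v\<close> by simp
    ultimately show False using xb[OF a(1)] z by simp
  qed
  have "proper_colouring G (2 ^ (card \<Sigma> ^ k)) (\<lambda>v. h (S v))"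
    unfolding proper_colouring_def
  proof (intro conjI allI impI)
    show "(\<lambda>v. h (S v)) \<in> {0..<order G} \<rightarrow> {0..<2 ^ (card \<Sigma> ^ k)}"
      using h \<open>\<And>v. S v \<in> _\<close> by (auto simp: bij_betw_def)
    show "h (S i) \<noteq> h (S j)" if "{i, j} \<in> edges G" for i j
      using neq[OF that] h \<open>\<And>v. S v \<in> _\<close> by (metis bij_betw_def inj_onD)
  qed
  then show ?thesis
    unfolding chromatic_number_def by (intro Least_le) blast
qed

section \<open>From a colouring to an index code of the arc graph\<close>

lemma colouring_consecutive_arcs:
  assumes G: "is_graph G" and chi: "chromatic_number G \<le> mid_binom k"
  obtains \<phi> where "\<And>e. e \<in> set (arcs G) \<Longrightarrow> \<phi> e < k"
    "\<And>e f. e \<in> set (arcs G) \<Longrightarrow> f \<in> set (arcs G) \<Longrightarrow> consecutive e f \<Longrightarrow> \<phi> e \<noteq> \<phi> f"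
proof -
  obtain c where c: "proper_colouring G (chromatic_number G) c"
    using chromatic_number_colouring[OF G] .
  define F where "F = {B. B \<subseteq> {0..<k} \<and> card B = k div 2}"
  have "card F = mid_binom k" unfolding F_def mid_binom_def by (subst n_subsets) auto
  moreover have "finite F" unfolding F_def by (rule finite_subset[of _ "Pow {0..<k}"]) auto
  ultimately obtain \<beta> where \<beta>: "bij_betw \<beta> {0..<mid_binom k} F"
    using ex_bij_betw_nat_finite[of F] by auto
  have cA: "c u < mid_binom k" if "u < order G" for u
  proof -
    have "c \<in> {0..<order G} \<rightarrow> {0..<chromatic_number G}"
      using c by (simp only: proper_colouring_def)
    then have "c u \<in> {0..<chromatic_number G}"
      by (rule Pi_mem) (simp add: that)
    with chi show ?thesis by simp
  qed
  define \<phi> where "\<phi> = (\<lambda>(u, v). SOME t. t \<in> \<beta> (c u) - \<beta> (c v))"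
  have \<phi>: "\<phi> (u, v) \<in> \<beta> (c u) - \<beta> (c v)" "\<beta> (c u) \<subseteq> {0..<k}" if "(u, v) \<in> set (arcs G)" for u v
  proof -
    have uv: "{u, v} \<in> edges G" using that G by (simp add: set_arcs)
    note o = is_graph_edgeD[OF G uv]
    have "c u \<noteq> c v" using c uv by (auto simp: proper_colouring_def)
    then have ne: "\<beta> (c u) \<noteq> \<beta> (c v)"
      using inj_onD[OF bij_betw_imp_inj_on[OF \<beta>], of "c u" "c v"] cA[OF o(1)] cA[OF o(2)] by auto
    have F: "\<beta> (c u) \<in> F" "\<beta> (c v) \<in> F"
      using cA[OF o(1)] cA[OF o(2)] by (auto intro: bij_betwE[OF \<beta>, rule_format])
    then show "\<beta> (c u) \<subseteq> {0..<k}" by (simp add: F_def)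
    \<comment> \<open>Finite sets of equal size form an antichain, so distinct colours always leave
      an element to choose.\<close>
    have "\<not> \<beta> (c u) \<subseteq> \<beta> (c v)"
    proof
      assume "\<beta> (c u) \<subseteq> \<beta> (c v)"
      moreover have "finite (\<beta> (c v))" "card (\<beta> (c u)) = card (\<beta> (c v))"
        using F by (auto simp: F_def intro: finite_subset[of _ "{0..<k}"])
      ultimately show False using ne card_subset_eq by blast
    qed
    then have "\<exists>t. t \<in> \<beta> (c u) - \<beta> (c v)" by blast
    then show "\<phi> (u, v) \<in> \<beta> (c u) - \<beta> (c v)"
      unfolding \<phi>_def prod.case by (rule someI_ex)
  qed
  have \<phi>': "\<phi> e \<in> \<beta> (c (fst e))" "\<phi> e \<notin> \<beta> (c (snd e))" "\<phi> e < k" if "e \<in> set (arcs G)" for e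
  proof -
    have "(fst e, snd e) \<in> set (arcs G)" using that by simp
    from \<phi>[OF this] show "\<phi> e \<in> \<beta> (c (fst e))" "\<phi> e \<notin> \<beta> (c (snd e))" "\<phi> e < k"
      by auto
  qed
  show thesis
  proof (rule that)
    show "\<phi> e < k" if "e \<in> set (arcs G)" for e
      by (rule \<phi>'[OF that])
    show "\<phi> e \<noteq> \<phi> f" if e: "e \<in> set (arcs G)" and f: "f \<in> set (arcs G)" and "consecutive e f" for e f
      \<comment> \<open>If e ends at the vertex where f starts, the set of that vertex contains
        \<open>\<phi> f\<close> but not \<open>\<phi> e\<close>; the other case is
        symmetric.\<close>
      using that(3) \<phi>'(1,2)[OF e] \<phi>'(1,2)[OF f] unfolding consecutive_def by auto
  qed
qed

lemma index_code_arc_graph: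
  assumes G: "is_graph G" and fin: "finite \<Sigma>" and ne: "\<Sigma> \<noteq> {}"
    and chi: "chromatic_number G \<le> mid_binom k"
  shows "\<exists>E. index_code \<Sigma> (arc_graph G) k E"
proof -
  let ?N = "length (arcs G)" and ?m = "card \<Sigma>"
  obtain \<phi> where \<phi>: "\<And>e. e \<in> set (arcs G) \<Longrightarrow> \<phi> e < k"
    "\<And>e f. e \<in> set (arcs G) \<Longrightarrow> f \<in> set (arcs G) \<Longrightarrow> consecutive e f \<Longrightarrow> \<phi> e \<noteq> \<phi> f"
    using colouring_consecutive_arcs[OF G chi] by blast
  define cl where "cl t = {b. b < ?N \<and> \<phi> (arcs G ! b) = t}" for t
  have m: "0 < ?m" using fin ne by (simp add: card_gt_0_iff)
  obtain h where h: "bij_betw h \<Sigma> {0..<?m}"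
    using ex_bij_betw_finite_nat[OF fin] by blast
  \<comment> \<open>\<open>h\<close> carries addition modulo the size of the alphabet over to
    \<Sigma>, and \<open>inv_into\<close> turns the sum back into a symbol.\<close>
  let ?s = "\<lambda>x t. (\<Sum>b\<in>cl t. h (x ! b)) mod ?m"
  define E where "E x = map (\<lambda>t. inv_into \<Sigma> h (?s x t)) [0..<k]" for x
  have inv: "inv_into \<Sigma> h s \<in> \<Sigma>" "h (inv_into \<Sigma> h s) = s" if "s < ?m" for s
    using that h by (metis atLeastLessThan_iff bij_betw_def inv_into_into zero_le,
       metis atLeastLessThan_iff bij_betw_inv_into_right zero_le)
  have "index_code \<Sigma> (arc_graph G) k E"
    unfolding index_code_iff[OF is_graph_arc_graph ne] order_arc_graph
  proof (intro conjI allI impI ballI)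
    show "E \<in> nlists ?N \<Sigma> \<rightarrow> nlists k \<Sigma>"
      using inv m by (auto simp: E_def nlists_def)
    fix a x y
    assume a: "a < ?N" and x: "x \<in> nlists ?N \<Sigma>" and y: "y \<in> nlists ?N \<Sigma>"
      and eq: "E x = E y \<and> (\<forall>b\<in>nbhd (arc_graph G) a. x ! b = y ! b)"
    define t where "t = \<phi> (arcs G ! a)"
    have t: "t < k" using \<phi>(1) a by (simp add: t_def)
    have "inv_into \<Sigma> h (?s x t) = inv_into \<Sigma> h (?s y t)"
      using eq t by (auto simp: E_def)
    then have s: "?s x t = ?s y t" using inv(2) m by (metis mod_less_divisor)
    \<comment> \<open>Arcs of equal colour are not consecutive, so every other member of the class
      is a neighbour of a and its symbol is known to the receiver.\<close>
    have "x ! b = y ! b" if "b \<in> cl t - {a}" for b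
    proof -
      have "b < ?N" "b \<noteq> a" "\<phi> (arcs G ! b) = \<phi> (arcs G ! a)"
        using that by (auto simp: cl_def t_def)
      then have "b \<in> nbhd (arc_graph G) a"
        using \<phi>(2)[of "arcs G ! a" "arcs G ! b"] a
        by (auto simp: nbhd_def edges_arc_graph_iff)
      then show ?thesis using eq by blast
    qed
    then have rest: "(\<Sum>b\<in>cl t - {a}. h (x ! b)) = (\<Sum>b\<in>cl t - {a}. h (y ! b))"
      by simp
    have "a \<in> cl t" "finite (cl t)" using a by (auto simp: cl_def t_def)
    then have "(\<Sum>b\<in>cl t. h (w ! b)) = h (w ! a) + (\<Sum>b\<in>cl t - {a}. h (w ! b))" for w
      by (rule sum.remove[rotated])
    with s rest have "(h (x ! a) + (\<Sum>b\<in>cl t - {a}. h (y ! b))) mod ?m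
        = (h (y ! a) + (\<Sum>b\<in>cl t - {a}. h (y ! b))) mod ?m"
      by simp
    \<comment> \<open>Cancelling the known summands leaves a congruence between two numbers below
      the modulus.\<close>
    then have "h (x ! a) mod ?m = h (y ! a) mod ?m"
      by (simp only: cong_add_rcancel_nat flip: cong_def)
    moreover have xy: "x ! a \<in> \<Sigma>" "y ! a \<in> \<Sigma>" using x y a by (auto intro: nlistsE_nth_in)
    moreover have "h (x ! a) < ?m" "h (y ! a) < ?m"
      using h xy by (auto simp: bij_betw_def)
    ultimately have "h (x ! a) = h (y ! a)" by simp
    then show "x ! a = y ! a" using h xy by (auto simp: bij_betw_def inj_on_def)
  qed
  then show ?thesis by blast
qed

lemma arc_graph_yes:
  assumes "is_graph G" "finite \<Sigma>" "\<Sigma> \<noteq> {}" "chromatic_number G \<le> mid_binom k"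
  shows "min_index_code_length \<Sigma> (arc_graph G) \<le> k"
  unfolding min_index_code_length_def by (rule Least_le) (rule index_code_arc_graph[OF assms])

lemma arc_graph_no:
  assumes G: "is_graph G" and fin: "finite \<Sigma>" and two: "card \<Sigma> \<ge> 2"
    and chi: "k \<le> chromatic_number G"
  shows "log (card \<Sigma>) (log 2 k) \<le> min_index_code_length \<Sigma> (arc_graph G)"
proof (cases "k < 2")
  case True
  \<comment> \<open>The logarithm of 0 is 0, so for k = 0 and k = 1 the inner and the outer
    logarithm both vanish.\<close>
  then have log: "log 2 k = 0" by (cases k) (auto simp: log_def less_Suc_eq)
  show ?thesis unfolding log by (simp add: log_def)
next
  case False
  let ?K = "min_index_code_length \<Sigma> (arc_graph G)"
  have "\<Sigma> \<noteq> {}" using two by auto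
  then obtain E where "index_code \<Sigma> (arc_graph G) ?K E"
    by (rule min_index_code[OF is_graph_arc_graph])
  from order_trans[OF chi chromatic_number_le_index_code[OF G fin two this]]
  have "real k \<le> real (2 ^ (card \<Sigma> ^ ?K))"
    by (simp only: of_nat_le_iff)
  then have "real k \<le> 2 ^ (card \<Sigma> ^ ?K)"
    by (simp only: of_nat_power of_nat_numeral)
  then have "log 2 k \<le> log 2 (2 ^ (card \<Sigma> ^ ?K))"
    using False by (intro log_mono) auto
  then have le: "log 2 k \<le> real (card \<Sigma>) ^ ?K" by (simp add: log_nat_power)
  \<comment> \<open>Monotonicity of the outer logarithm needs a positive argument, which is why k <
    2 is a separate case.\<close>
  have "0 < log 2 k" using False by simp
  then have "log (card \<Sigma>) (log 2 k) \<le> log (card \<Sigma>) (real (card \<Sigma>) ^ ?K)"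
    using le two by (intro log_mono) auto
  also have "\<dots> = ?K" using two by (simp add: log_nat_power)
  finally show ?thesis .
qed

section \<open>A Turing machine for the arc graph\<close>

definition runs :: "tm \<Rightarrow> nat \<Rightarrow> config \<Rightarrow> config \<Rightarrow> bool" where
  "runs M T c c' \<longleftrightarrow> (\<exists>t\<le>T. (step M ^^ t) c = c')"

lemma runs_refl: "runs M 0 c c"
  by (simp add: runs_def)

lemma runs_step: "step M c = c' \<Longrightarrow> runs M 1 c c'"
  unfolding runs_def by (rule exI[of _ 1]) simp

lemma runs_trans [trans]: "runs M T a b \<Longrightarrow> runs M U b c \<Longrightarrow> runs M (T + U) a c"
proof -
  assume "runs M T a b" "runs M U b c"
  then obtain t u where "t \<le> T" "(step M ^^ t) a = b" "u \<le> U" "(step M ^^ u) b = c"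
    by (auto simp: runs_def)
  then have "u + t \<le> T + U" "(step M ^^ (u + t)) a = c"
    by (simp_all add: funpow_add)
  then show ?thesis by (auto simp: runs_def)
qed

lemma runs_mono: "runs M T a b \<Longrightarrow> T \<le> U \<Longrightarrow> runs M U a b"
  unfolding runs_def using le_trans by blast

text \<open>\<open>f m\<close> is the configuration after m rounds, so verifying a loop of the
  machine amounts to exhibiting the family \<open>f\<close>.\<close>

lemma runs_loop:
  assumes "\<And>m. m < n \<Longrightarrow> runs M T (f m) (f (Suc m))"
  shows "runs M (n * T) (f 0) (f n)"
  using assms
proof (induction n)
  case 0
  then show ?case by (simp add: runs_refl)
next
  case (Suc n)
  then have "runs M (n * T) (f 0) (f n)" "runs M T (f n) (f (Suc n))"
    by auto
  then have "runs M (n * T + T) (f 0) (f (Suc n))"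
    by (rule runs_trans)
  then show ?case by (simp add: add.commute)
qed

section \<open>Tapes that hold a word\<close>

definition tape_at :: "bool list \<Rightarrow> int \<Rightarrow> tape" where
  "tape_at w p = (\<lambda>i. word_tape w (i + p))"

text \<open>The shape of a tape under construction: writing a bit and moving right reproduces it for
  the longer word.\<close>

definition tape_end :: "bool list \<Rightarrow> tape" where
  "tape_end w = tape_at w (int (length w))"

lemma tape_at_0 [simp]: "tape_at w p 0 = word_tape w p"
  by (simp add: tape_at_def)

lemma tape_end_0 [simp]: "tape_end w 0 = 0"
  by (simp add: tape_end_def word_tape_def)

lemma act_stay [simp]: "act (t 0, Stay) t = t"
  by (simp add: act_def)

text \<open>The equation for s is a premise so that the rule also fires after the scanned symbol has
  been rewritten to a numeral.\<close>

lemma act_tape_at [simp]: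
  assumes "s = word_tape w p"
  shows "act (s, Move_Left) (tape_at w p) = tape_at w (p - 1)"
    "act (s, Stay) (tape_at w p) = tape_at w p"
    "act (s, Move_Right) (tape_at w p) = tape_at w (p + 1)"
proof -
  have "(tape_at w p)(0 := s) = tape_at w p"
    using assms by (intro fun_upd_idem) simp
  then show "act (s, Move_Left) (tape_at w p) = tape_at w (p - 1)"
    "act (s, Stay) (tape_at w p) = tape_at w p"
    "act (s, Move_Right) (tape_at w p) = tape_at w (p + 1)"
    unfolding act_def
    by (simp_all add: tape_at_def add_diff_eq diff_add_eq add.assoc add.commute[of 1])
qed

lemma act_tape_end_move [simp]:
  "act (0, Move_Left) (tape_end w) = tape_at w (int (length w) - 1)"
  "act (0, Stay) (tape_end w) = tape_end w"
proof -
  have "word_tape w (int (length w)) = 0"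
    by (simp add: word_tape_def)
  with act_tape_at[of 0 w "int (length w)"]
  show "act (0, Move_Left) (tape_end w) = tape_at w (int (length w) - 1)"
    "act (0, Stay) (tape_end w) = tape_end w"
    by (simp_all add: tape_end_def)
qed

lemma act_tape_end_write:
  "act (if b then 2 else 1, Move_Right) (tape_end w) = tape_end (w @ [b])"
proof -
  have "word_tape w (i + int (length w)) = word_tape (w @ [b]) (i + int (length w))" if "i \<noteq> 0" for i
    using that by (auto simp: word_tape_def nth_append)
  then have "(tape_end w)(0 := if b then 2 else 1) = (\<lambda>i. word_tape (w @ [b]) (i + int (length w)))"
    unfolding tape_end_def tape_at_def by (simp add: fun_eq_iff) (simp add: word_tape_def)
  then show ?thesis
    unfolding act_def by (simp add: tape_end_def tape_at_def add.assoc add.commute[of 1])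
qed

lemmas act_tape_end_write' [simp] =
  act_tape_end_write[of False, simplified] act_tape_end_write[of True, simplified]

lemma act_mark: "act (2, Stay) (tape_end []) = tape_at [True] 0"
  by (rule ext) (simp add: act_def tape_at_def tape_end_def word_tape_def)

text \<open>A blank on a mark tape says that the two indices whose difference is the displacement of
  its head are unequal.\<close>

lemma word_tape_mark: "word_tape [True] p = 0 \<longleftrightarrow> p \<noteq> 0"
  by (auto simp: word_tape_def)

lemma word_tape_replicate: "word_tape (replicate n True) p = 0 \<longleftrightarrow> p < 0 \<or> int n \<le> p"
  by (auto simp: word_tape_def)

lemma word_tape_eq_0: "word_tape w p = 0 \<longleftrightarrow> p < 0 \<or> int (length w) \<le> p"
  by (auto simp: word_tape_def)

text \<open>Tapes: 0 the input, with the head on the entry (i, j) of the matrix in the main loop; 1 the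
  output; 2 a copy of the matrix, with the head on the entry (k, l); 3 and 4 the number n in unary,
  with heads at l and j. The indices are never compared directly: tapes 5, 6 and 7 carry a single
  mark, and their heads are at distance \<open>k - j\<close>, \<open>l - i\<close> and \<open>(k n + l) - (i n + j)\<close> from it.

  States: 0 writes the marks; 1 and 2 copy the input to tapes 2--4 and write the order of the new
  graph; 3 and 4 rewind; 5 is the loop over (i, j) and 6 its end of line; 7 is the loop over (k, l)
  and 8 its end of line; 9, 10 and 11 reset k, l and the copy; 12 rewinds the output.\<close>

definition arc_delta :: "nat \<Rightarrow> nat list \<Rightarrow> nat \<times> (nat \<times> move) list" where
  "arc_delta q ss = (let L = Move_Left; S = Stay; R = Move_Right in
    if q = 0 then (1, (zip ss [S,S,S,S,S,S,S,S])[5 := (2,S), 6 := (2,S), 7 := (2,S)])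
    else if q = 1 then
      (if ss!0 = 2 then (1, (zip ss [R,S,S,S,S,S,S,S])[3 := (2,R), 4 := (2,R)])
       else (2, zip ss [R,S,S,S,S,S,S,S]))
    else if q = 2 then
      (if ss!0 = 0 then (3, (zip ss [L,S,L,L,L,S,S,S])[1 := (1,R)])
       else if ss!0 = 1 then (2, (zip ss [R,S,S,S,S,S,S,S])[2 := (1,R)])
       else (2, (zip ss [R,S,S,S,S,S,S,S])[1 := (2,R), 2 := (2,R)]))
    else if q = 3 then
      (if ss!2 \<noteq> 0 then (3, zip ss [L,S,L,S,S,S,S,S])
       else (4, zip ss [R,S,R,S,S,S,S,S]))
    else if q = 4 then
      (if ss!3 \<noteq> 0 then (4, zip ss [S,S,S,L,L,S,S,S])
       else if ss!0 = 0 then (12, zip ss [S,L,S,R,R,S,S,S])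
       else (5, zip ss [S,S,S,R,R,S,S,S]))
    else if q = 5 then
      (if ss!4 = 0 then (6, zip ss [S,S,S,S,L,S,L,S])
       else if ss!0 = 0 then (12, zip ss [S,L,S,S,S,S,S,S])
       else if ss!0 = 1 then (5, zip ss [R,S,S,S,R,L,S,L])
       else (7, zip ss [S,S,S,S,S,S,S,S]))
    else if q = 6 then
      (if ss!4 \<noteq> 0 then (6, zip ss [S,S,S,S,L,R,S,S])
       else (5, zip ss [S,S,S,S,R,S,S,S]))
    else if q = 7 then
      (if ss!3 = 0 then (8, zip ss [S,S,S,L,S,R,S,S])
       else if ss!2 = 0 then (9, zip ss [S,S,S,S,S,S,S,S])
       else if ss!2 = 1 then (7, zip ss [S,S,R,R,S,S,R,R])
       else (7, (zip ss [S,S,R,R,S,S,R,R])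
                 [1 := (if ss!5 = 0 \<and> ss!6 = 0 \<and> ss!7 = 0 then 2 else 1, R)]))
    else if q = 8 then
      (if ss!3 \<noteq> 0 then (8, zip ss [S,S,S,L,S,S,L,S])
       else (7, zip ss [S,S,S,R,S,S,S,S]))
    else if q = 9 then
      (if ss!3 \<noteq> 0 then (9, zip ss [S,S,S,R,S,L,S,S])
       else (10, zip ss [S,S,L,L,S,S,S,L]))
    else if q = 10 then
      (if ss!3 \<noteq> 0 then (10, zip ss [S,S,S,L,S,S,S,S])
       else (11, zip ss [S,S,S,R,S,S,S,S]))
    else if q = 11 then
      (if ss!2 \<noteq> 0 then (11, zip ss [S,S,L,S,S,S,S,L])
       else (5, zip ss [R,S,R,S,R,L,S,S]))
    else
      (if ss!1 \<noteq> 0 then (12, zip ss [S,L,S,S,S,S,S,S])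
       else (13, zip ss [S,R,S,S,S,S,S,S])))"

definition arc_tm :: tm where
  "arc_tm = \<lparr>num_tapes = 8, num_states = 13, num_syms = 3, delta = arc_delta\<rparr>"

lemma zip_in_nlists:
  "ss \<in> nlists n A \<Longrightarrow> length ms = n \<Longrightarrow> zip ss ms \<in> nlists n (A \<times> UNIV)"
  unfolding nlists_def by (safe; (blast dest: set_zip_leftD)?) simp_all

lemma tm_wf_arc_tm: "tm_wf arc_tm"
proof -
  \<comment> \<open>This rule passes through the nested conditionals of the transition table branch
    by branch, whatever their tests.\<close>
  have if_mem: "x \<in> X \<Longrightarrow> y \<in> X \<Longrightarrow> (if P then x else y) \<in> X" for x y :: 'b and X P
    by simp
  have "arc_delta q ss \<in> {..13} \<times> nlists 8 ({0..<3} \<times> UNIV)"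
    if "ss \<in> nlists 8 {0..<3}" for q ss
    unfolding arc_delta_def Let_def
    by (intro if_mem SigmaI nlists_update_in_list zip_in_nlists that; simp)
  then have "fst (arc_delta q ss) \<le> 13 \<and> snd (arc_delta q ss) \<in> nlists 8 ({0..<3} \<times> UNIV)"
    if "ss \<in> nlists 8 {0..<3}" for q ss
    using that by (simp only: mem_Times_iff atMost_iff)
  then show ?thesis
    by (simp only: tm_wf_def arc_tm_def tm.simps) simp
qed

lemma step_arc_tm:
  "s < 13 \<Longrightarrow> step arc_tm (s, ts) =
    (let r = arc_delta s (map (\<lambda>t. t 0) ts) in (fst r, map2 act (snd r) ts))"
  by (simp add: step_def arc_tm_def)

section \<open>Row-major layout of matrices\<close>

definition mat :: "nat \<Rightarrow> (nat \<Rightarrow> nat \<Rightarrow> bool) \<Rightarrow> bool list" where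
  "mat n A = concat (map (\<lambda>i. map (A i) [0..<n]) [0..<n])"

text \<open>\<open>line\<close> and \<open>grid\<close> describe the output of unfinished nested
  loops: m counts the cells of a row, or the rows, already done, and a cell may contribute any
  number of bits.\<close>

definition line :: "(nat \<Rightarrow> nat \<Rightarrow> 'b list) \<Rightarrow> nat \<Rightarrow> nat \<Rightarrow> 'b list" where
  "line f i m = concat (map (f i) [0..<m])"

definition grid :: "nat \<Rightarrow> (nat \<Rightarrow> nat \<Rightarrow> 'b list) \<Rightarrow> nat \<Rightarrow> 'b list" where
  "grid n f m = concat (map (\<lambda>i. line f i n) [0..<m])"

lemma line_simps [simp]: "line f i 0 = []" "line f i (Suc m) = line f i m @ f i m"
  by (simp_all add: line_def)

lemma grid_simps [simp]: "grid n f 0 = []" "grid n f (Suc m) = grid n f m @ line f m n"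
  by (simp_all add: grid_def)

lemma mat_nth:
  assumes "i < n" "j < n"
  shows "mat n A ! (i * n + j) = A i j"
proof -
  have len: "length (concat (map (\<lambda>i. map (A i) [0..<n]) [0..<m])) = m * n" for m
    by (induction m) auto
  \<comment> \<open>The number m of rows is kept apart from the row length n for the sake of the
    induction.\<close>
  have "concat (map (\<lambda>i. map (A i) [0..<n]) [0..<m]) ! (i * n + j) = A i j" if "i < m" for m
    using that
  proof (induction m)
    case (Suc m)
    show ?case
    proof (cases "i = m")
      case True
      then show ?thesis using assms by (simp add: nth_append len)
    next
      case False
      with Suc.prems have "i < m" by simp
      then have "i * n + n \<le> m * n"
        by (metis Suc_leI add.commute mult_Suc mult_le_mono1)
      then have "i * n + j < m * n"
        using assms(2) by linarith
      then show ?thesis using Suc.IH \<open>i < m\<close> by (simp add: nth_append len)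
    qed
  qed simp
  then show ?thesis using assms by (simp add: mat_def)
qed

lemma length_mat [simp]: "length (mat n A) = n * n"
proof -
  have "length (concat (map (\<lambda>i. map (A i) [0..<n]) [0..<m])) = m * n" for m
    by (induction m) auto
  then show ?thesis by (simp add: mat_def)
qed

lemma cell_less: "i < n \<Longrightarrow> j < n \<Longrightarrow> i * n + j < n * (n::nat)"
  by (metis add.commute add_less_cancel_left less_le_trans mult_Suc mult_le_mono1 Suc_leI)

lemma cell_inj:
  fixes i j k l n :: nat
  assumes "j < n" "l < n"
  shows "i * n + j = k * n + l \<longleftrightarrow> i = k \<and> j = l"
proof
  assume h: "i * n + j = k * n + l"
  then have "(i * n + j) div n = (k * n + l) div n" "(i * n + j) mod n = (k * n + l) mod n"
    by simp_all
  then show "i = k \<and> j = l" using assms by simp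
qed simp

definition inp :: "nat \<Rightarrow> (nat \<Rightarrow> nat \<Rightarrow> bool) \<Rightarrow> bool list" where
  "inp n A = replicate n True @ False # mat n A"

lemma length_inp: "length (inp n A) = n + 1 + n * n"
  by (simp add: inp_def)

lemma word_tape_inp_unary:
  "m < n \<Longrightarrow> word_tape (inp n A) (int m) = 2"
  "word_tape (inp n A) (int n) = 1"
proof -
  have "int m < int (length (inp n A))" if "m \<le> n" for m
    using that by (simp only: of_nat_less_iff length_inp)
  moreover have "m < n \<Longrightarrow> inp n A ! m" "\<not> inp n A ! n"
    by (simp_all add: inp_def nth_append)
  ultimately show "m < n \<Longrightarrow> word_tape (inp n A) (int m) = 2" "word_tape (inp n A) (int n) = 1"
    by (simp_all add: word_tape_def)
qed

lemma word_tape_inp_mat: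
  assumes "0 \<le> q"
  shows "word_tape (inp n A) (int n + 1 + q) = word_tape (mat n A) q"
proof -
  have "nat (int n + 1 + q) = n + Suc (nat q)"
    using assms by linarith
  then show ?thesis
    using assms by (auto simp: word_tape_def inp_def nth_append)
qed

lemma word_tape_mat:
  assumes "i < n" "j < n"
  shows "word_tape (mat n A) (int i * int n + int j) = (if A i j then 2 else 1)"
proof -
  have "nat (int i * int n + int j) = i * n + j"
    by (metis nat_int of_nat_add of_nat_mult)
  moreover have "int i * int n + int j < int (n * n)"
    using cell_less[OF assms] by (metis of_nat_add of_nat_less_iff of_nat_mult)
  ultimately show ?thesis
    using mat_nth[OF assms] by (simp add: word_tape_def)
qed

text \<open>Evaluates the updates by position in \<open>arc_delta\<close>.\<close>

lemma list_update_Cons_numeral [simp]: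
  "(x # xs)[numeral v := y] = x # xs[pred_numeral v := y]"
  by (simp add: numeral_eq_Suc)

section \<open>The nested loops of the machine on an arbitrary Boolean matrix\<close>

locale adjacency_matrix =
  fixes n :: nat and A :: "nat \<Rightarrow> nat \<Rightarrow> bool"
begin

text \<open>Between the copying phase and the final rewinding only the state, the output word and
  seven head positions vary.\<close>

definition cfg :: "nat \<Rightarrow> int \<Rightarrow> bool list \<Rightarrow> int \<Rightarrow> int \<Rightarrow> int \<Rightarrow> int \<Rightarrow> int \<Rightarrow> int \<Rightarrow> config" where
  "cfg s P w Q L J a b d = (s, [tape_at (inp n A) P, tape_end w, tape_at (mat n A) Q,
     tape_at (replicate n True) L, tape_at (replicate n True) J,
     tape_at [True] a, tape_at [True] b, tape_at [True] d])"

text \<open>Adjacency of the arcs (i, j) and (k, l) in the arc graph, with one conjunct for each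
  mark tape; the last one excludes the diagonal.\<close>

definition bit :: "nat \<Rightarrow> nat \<Rightarrow> nat \<Rightarrow> nat \<Rightarrow> bool" where
  "bit i j k l \<longleftrightarrow> k \<noteq> j \<and> l \<noteq> i \<and> (k,l) \<noteq> (i,j)"

definition cell :: "nat \<Rightarrow> nat \<Rightarrow> nat \<Rightarrow> nat \<Rightarrow> bool list" where
  "cell i j k l = (if A k l then [bit i j k l] else [])"

definition pos :: "nat \<Rightarrow> nat \<Rightarrow> int" where "pos i j = int i * int n + int j"

text \<open>The invariant of the loop over (k, l): l = n is the end of a row and k = n the end of
  the pass. The offset n + 1 skips the unary order and the separator.\<close>

definition inner :: "nat \<Rightarrow> nat \<Rightarrow> bool list \<Rightarrow> nat \<Rightarrow> nat \<Rightarrow> config" where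
  "inner i j w k l = cfg 7 (int n + 1 + pos i j) w (pos k l) (int l) (int j)
     (int k - int j) (int l - int i) (pos k l - pos i j)"

definition outer :: "nat \<Rightarrow> nat \<Rightarrow> bool list \<Rightarrow> config" where
  "outer i j w = cfg 5 (int n + 1 + pos i j) w 0 0 (int j) (- int j) (- int i) (- pos i j)"

lemmas step_simps = cfg_def step_arc_tm arc_delta_def minus_diff_commute

lemma pos_Suc: "pos i (Suc j) = pos i j + 1" "pos (Suc i) 0 = pos i n"
  by (simp_all add: pos_def algebra_simps)

lemma pos_eq_iff: "j < n \<Longrightarrow> l < n \<Longrightarrow> pos i j = pos k l \<longleftrightarrow> i = k \<and> j = l"
  unfolding pos_def by (metis cell_inj of_nat_add of_nat_eq_iff of_nat_mult)

lemma inner_step: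
  assumes "i < n" "j < n" "k < n" "l < n"
  shows "step arc_tm (inner i j w k l) = inner i j (w @ cell i j k l) k (Suc l)"
proof -
  have m: "word_tape (mat n A) (pos k l) = (if A k l then 2 else 1)"
    using word_tape_mat[OF assms(3,4)] by (simp add: pos_def)
  have u: "word_tape (replicate n True) (int l) \<noteq> 0"
    using assms by (simp add: word_tape_replicate)
  \<comment> \<open>The third mark tape compares positions in the matrix; since j and l are below n,
    equal positions mean equal cells.\<close>
  have b: "bit i j k l \<longleftrightarrow> word_tape [True] (int k - int j) = 0 \<and> word_tape [True] (int l - int i) = 0
    \<and> word_tape [True] (pos k l - pos i j) = 0"
    using assms by (auto simp: word_tape_mark bit_def pos_eq_iff)
  show ?thesis
    using m u
    by (auto simp: inner_def step_simps cell_def b pos_Suc algebra_simps)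
qed

lemma inner_line:
  assumes "i < n" "j < n" "k < n"
  shows "runs arc_tm n (inner i j w k 0) (inner i j (w @ line (cell i j) k n) k n)"
proof -
  have "runs arc_tm (n * 1) (inner i j (w @ line (cell i j) k 0) k 0)
      (inner i j (w @ line (cell i j) k n) k n)"
    by (rule runs_loop) (rule runs_step, simp add: inner_step assms)
  then show ?thesis by simp
qed


lemma inner_line_end:
  "runs arc_tm (n + 2) (inner i j w k n) (inner i j w (Suc k) 0)"
proof -
  \<comment> \<open>Entering state 8 moves tape 3 left and tape 5 right, the latter for the new k.
    Tape 3 then counts the n moves by which tape 6 resets l. The copy on tape 2 stays, as the end of
    row k is the start of the next row.\<close>
  define f where "f m = cfg 8 (int n + 1 + pos i j) w (pos k n) (int n - 1 - int m) (int j)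
     (int k + 1 - int j) (int n - int m - int i) (pos k n - pos i j)" for m
  have "word_tape (replicate n True) (int n) = 0"
    by (simp add: word_tape_replicate)
  then have "runs arc_tm 1 (inner i j w k n) (f 0)"
    by (intro runs_step) (simp add: inner_def f_def step_simps algebra_simps)
  also have "runs arc_tm (n * 1) (f 0) (f n)"
  proof (intro runs_loop runs_step)
    fix m assume "m < n"
    then have "word_tape (replicate n True) (int n - 1 - int m) \<noteq> 0"
      by (simp add: word_tape_replicate)
    then show "step arc_tm (f m) = f (Suc m)"
      by (simp add: f_def step_simps algebra_simps)
  qed
  also have "runs arc_tm 1 (f n) (inner i j w (Suc k) 0)"
  proof (rule runs_step)
    have "word_tape (replicate n True) (- 1) = 0"
      by (simp add: word_tape_replicate)
    then show "step arc_tm (f n) = inner i j w (Suc k) 0"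
      by (simp add: inner_def f_def step_simps pos_Suc algebra_simps)
  qed
  finally show ?thesis by simp
qed

lemma inner_grid:
  assumes "i < n" "j < n"
  shows "runs arc_tm (n * (2 * n + 2)) (inner i j w 0 0) (inner i j (w @ grid n (cell i j) n) n 0)"
proof -
  have "runs arc_tm (n * (2 * n + 2)) (inner i j (w @ grid n (cell i j) 0) 0 0)
     (inner i j (w @ grid n (cell i j) n) n 0)"
  proof (rule runs_loop)
    fix k assume "k < n"
    then have "runs arc_tm (n + (n + 2)) (inner i j (w @ grid n (cell i j) k) k 0)
       (inner i j ((w @ grid n (cell i j) k) @ line (cell i j) k n) (Suc k) 0)"
      using assms by (intro runs_trans[OF inner_line inner_line_end])
    then show "runs arc_tm (2 * n + 2) (inner i j (w @ grid n (cell i j) k) k 0)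
       (inner i j (w @ grid n (cell i j) (Suc k)) (Suc k) 0)"
      by (simp add: mult_2 add.assoc)
  qed
  then show ?thesis by simp
qed

text \<open>State 9 uses tape 3 to count k back from n to 0 on tape 5, state 10 returns tape 3, and
  state 11 rewinds the copy together with tape 7. Tape 7 moves left n * n + 1 times in all; the
  extra move, like the last one of tape 5, accounts for the new j.\<close>

lemma inner_exit:
  assumes "i < n" "j < n"
  shows "runs arc_tm (n * n + 2 * n + 4) (inner i j w n 0) (outer i (Suc j) w)"
proof -
  let ?P = "int n + 1 + pos i j" and ?N = "int n * int n"
  define f where "f m = cfg 9 ?P w ?N (int m) (int j)
     (int n - int m - int j) (- int i) (?N - pos i j)" for m
  define g where "g m = cfg 10 ?P w (?N - 1) (int n - 1 - int m) (int j)
     (- int j) (- int i) (?N - pos i j - 1)" for m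
  define h where "h m = cfg 11 ?P w (?N - 1 - int m) 0 (int j)
     (- int j) (- int i) (?N - pos i j - 1 - int m)" for m
  have un: "word_tape (replicate n True) (int n) = 0" "word_tape (replicate n True) (- 1) = 0"
    "word_tape (replicate n True) 0 \<noteq> 0"
    using assms by (auto simp: word_tape_replicate)
  have ma: "word_tape (mat n A) ?N = 0" "word_tape (mat n A) (- 1) = 0"
    by (auto simp: word_tape_eq_0)
  have pos: "pos n 0 = ?N"
    by (simp add: pos_def)
  have "runs arc_tm 1 (inner i j w n 0) (f 0)"
    using un ma by (intro runs_step) (simp add: inner_def f_def step_simps pos)
  also have "runs arc_tm (n * 1) (f 0) (f n)"
  proof (intro runs_loop runs_step)
    fix m assume "m < n"
    then have "word_tape (replicate n True) (int m) \<noteq> 0"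
      by (simp add: word_tape_replicate)
    then show "step arc_tm (f m) = f (Suc m)"
      by (simp add: f_def step_simps algebra_simps)
  qed
  also have "runs arc_tm 1 (f n) (g 0)"
    using un by (intro runs_step) (simp add: f_def g_def step_simps)
  also have "runs arc_tm (n * 1) (g 0) (g n)"
  proof (intro runs_loop runs_step)
    fix m assume "m < n"
    then have "word_tape (replicate n True) (int n - 1 - int m) \<noteq> 0"
      by (simp add: word_tape_replicate)
    then show "step arc_tm (g m) = g (Suc m)"
      by (simp add: g_def step_simps algebra_simps)
  qed
  also have "runs arc_tm 1 (g n) (h 0)"
    using un by (intro runs_step) (simp add: g_def h_def step_simps)
  also have "runs arc_tm (n * n * 1) (h 0) (h (n * n))"
  proof (intro runs_loop runs_step)
    fix m assume "m < n * n"
    then have "int m < ?N" by (metis of_nat_less_iff of_nat_mult)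
    then have "word_tape (mat n A) (?N - 1 - int m) \<noteq> 0"
      by (simp add: word_tape_eq_0)
    then show "step arc_tm (h m) = h (Suc m)"
      by (simp add: h_def step_simps algebra_simps)
  qed
  also have "runs arc_tm 1 (h (n * n)) (outer i (Suc j) w)"
    using ma by (intro runs_step) (simp add: h_def outer_def step_simps pos_Suc algebra_simps)
  finally show ?thesis by (rule runs_mono) simp
qed

definition block :: "nat \<Rightarrow> nat \<Rightarrow> bool list" where
  "block i j = (if A i j then grid n (cell i j) n else [])"

lemma outer_step:
  assumes "i < n" "j < n"
  shows "runs arc_tm (3 * n * n + 4 * n + 5) (outer i j w) (outer i (Suc j) (w @ block i j))"
proof -
  have un: "word_tape (replicate n True) (int j) \<noteq> 0"
    using assms by (simp add: word_tape_replicate)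
  have "0 \<le> pos i j"
    by (simp add: pos_def)
  then have inp: "word_tape (inp n A) (int n + 1 + pos i j) = (if A i j then 2 else 1)"
    using word_tape_mat[OF assms] by (simp add: word_tape_inp_mat) (simp add: pos_def)
  show ?thesis
  proof (cases "A i j")
    case True
    then have "runs arc_tm 1 (outer i j w) (inner i j w 0 0)"
      using un inp
      by (intro runs_step) (simp add: outer_def inner_def step_simps pos_def[of 0 0])
    also note inner_grid[OF assms]
    also note inner_exit[OF assms]
    \<comment> \<open>Entry into the pass, the pass itself and the reset add up to the time bound; a
      zero entry costs a single step.\<close>
    finally have "runs arc_tm (1 + n * (2 * n + 2) + (n * n + 2 * n + 4)) (outer i j w)
      (outer i (Suc j) (w @ block i j))"
      using True by (simp add: block_def)
    then show ?thesis by (rule runs_mono) (simp add: algebra_simps)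
  next
    case False
    then have "runs arc_tm 1 (outer i j w) (outer i (Suc j) w)"
      using un inp
      by (intro runs_step) (simp add: outer_def step_simps pos_Suc algebra_simps)
    then show ?thesis
      using False by (auto simp: block_def intro: runs_mono)
  qed
qed

lemma outer_line_end: "runs arc_tm (n + 2) (outer i n w) (outer (Suc i) 0 w)"
proof -
  \<comment> \<open>Entering state 6 moves tape 6 left for the new i; tape 4 then counts the n moves
    by which tape 5 resets j.\<close>
  define f where "f m = cfg 6 (int n + 1 + pos i n) w 0 0 (int n - 1 - int m)
     (int m - int n) (- 1 - int i) (- pos i n)" for m
  have un: "word_tape (replicate n True) (int n) = 0" "word_tape (replicate n True) (- 1) = 0"
    by (auto simp: word_tape_replicate)
  then have "runs arc_tm 1 (outer i n w) (f 0)"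
    by (intro runs_step) (simp add: outer_def f_def step_simps algebra_simps)
  also have "runs arc_tm (n * 1) (f 0) (f n)"
  proof (intro runs_loop runs_step)
    fix m assume "m < n"
    then have "word_tape (replicate n True) (int n - 1 - int m) \<noteq> 0"
      by (simp add: word_tape_replicate)
    then show "step arc_tm (f m) = f (Suc m)"
      by (simp add: f_def step_simps algebra_simps)
  qed
  also have "runs arc_tm 1 (f n) (outer (Suc i) 0 w)"
    using un by (intro runs_step) (simp add: outer_def f_def step_simps pos_Suc algebra_simps)
  finally show ?thesis by simp
qed

lemma outer_grid:
  "runs arc_tm (n * (n * (3 * n * n + 4 * n + 5) + (n + 2))) (outer 0 0 w)
     (outer n 0 (w @ grid n block n))"
proof -
  have "runs arc_tm (n * (n * (3 * n * n + 4 * n + 5) + (n + 2)))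
     (outer 0 0 (w @ grid n block 0)) (outer n 0 (w @ grid n block n))"
  proof (rule runs_loop)
    fix i assume i: "i < n"
    have "runs arc_tm (n * (3 * n * n + 4 * n + 5))
       (outer i 0 ((w @ grid n block i) @ line block i 0))
       (outer i n ((w @ grid n block i) @ line block i n))"
      by (rule runs_loop) (use outer_step i in \<open>simp flip: append_assoc\<close>)
    from runs_trans[OF this outer_line_end]
    show "runs arc_tm (n * (3 * n * n + 4 * n + 5) + (n + 2))
       (outer i 0 (w @ grid n block i)) (outer (Suc i) 0 (w @ grid n block (Suc i)))"
      by simp
  qed
  then show ?thesis by simp
qed

section \<open>Initial copying, final rewinding and the whole run\<close>

lemma finish:
  "\<exists>ts. runs arc_tm (length w + 1)
     (12, [t0, tape_at w (int (length w) - 1), t2, t3, t4, t5, t6, t7]) (13, ts) \<and> ts ! 1 = word_tape w"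
proof -
  define f where "f m = (12::nat, [t0, tape_at w (int (length w) - 1 - int m), t2, t3, t4, t5, t6, t7])" for m
  have "runs arc_tm (length w * 1) (f 0) (f (length w))"
  proof (intro runs_loop runs_step)
    fix m assume "m < length w"
    then have "word_tape w (int (length w) - 1 - int m) \<noteq> 0"
      by (simp add: word_tape_eq_0)
    then show "step arc_tm (f m) = f (Suc m)"
      by (simp add: f_def step_simps algebra_simps)
  qed
  also have "runs arc_tm 1 (f (length w)) (13, [t0, tape_at w 0, t2, t3, t4, t5, t6, t7])"
  proof (rule runs_step)
    have "word_tape w (- 1) = 0"
      by (simp add: word_tape_eq_0)
    then show "step arc_tm (f (length w)) = (13, [t0, tape_at w 0, t2, t3, t4, t5, t6, t7])"
      by (simp add: f_def step_simps)
  qed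
  finally show ?thesis
    by (intro exI[of _ "[t0, tape_at w 0, t2, t3, t4, t5, t6, t7]"]) (simp add: f_def tape_at_def)
qed


text \<open>Each nonzero entry contributes one \<open>True\<close>, which gives the order of the new
  graph in unary; the final \<open>False\<close> is the separator.\<close>

definition header :: "bool list" where
  "header = filter id (mat n A) @ [False]"

lemma start:
  "runs arc_tm (2 * n * n + 2 * n + 4) (init_config arc_tm (inp n A))
     (cfg 4 (int n + 1) header 0 (int n - 1) (int n - 1) 0 0 0)"
proof -
  let ?un = "replicate n True"
  define f where "f m = (1::nat, [tape_at (inp n A) (int m), tape_end [], tape_end [],
     tape_end (replicate m True), tape_end (replicate m True),
     tape_at [True] 0, tape_at [True] 0, tape_at [True] 0])" for m
  \<comment> \<open>While the matrix is copied, each nonzero entry also extends the unary order on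
    the output tape.\<close>
  define g where "g q = (2::nat, [tape_at (inp n A) (int n + 1 + int q),
     tape_end (filter id (take q (mat n A))), tape_end (take q (mat n A)),
     tape_end ?un, tape_end ?un,
     tape_at [True] 0, tape_at [True] 0, tape_at [True] 0])" for q
  \<comment> \<open>Tapes 0 and 2 move left together. When tape 2 reaches the blank at -1, tape 0 is
    on the separator at n, and one step right puts both on entry (0, 0).\<close>
  define h where "h q = cfg 3 (int n + int (n * n) - int q) header (int (n * n) - 1 - int q)
     (int n - 1) (int n - 1) 0 0 0" for q
  have init: "init_config arc_tm (inp n A) =
     (0, [tape_at (inp n A) 0, tape_end [], tape_end [], tape_end [], tape_end [],
       tape_end [], tape_end [], tape_end []])"
    by (simp add: init_config_def arc_tm_def tape_at_def tape_end_def numeral_eq_Suc)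
  have "runs arc_tm 1 (init_config arc_tm (inp n A)) (f 0)"
    unfolding init
    by (intro runs_step) (simp add: f_def step_simps act_mark)
  also have "runs arc_tm (n * 1) (f 0) (f n)"
  proof (intro runs_loop runs_step)
    fix m assume "m < n"
    then have "word_tape (inp n A) (int m) = 2"
      by (rule word_tape_inp_unary)
    then show "step arc_tm (f m) = f (Suc m)"
      by (simp add: f_def step_simps replicate_append_same algebra_simps)
  qed
  also have "runs arc_tm 1 (f n) (g 0)"
    using word_tape_inp_unary(2)[of n A]
    by (intro runs_step) (simp add: f_def g_def step_simps algebra_simps)
  also have "runs arc_tm (n * n * 1) (g 0) (g (n * n))"
  proof (intro runs_loop runs_step)
    fix q assume q: "q < n * n"
    then have "word_tape (inp n A) (int n + 1 + int q) = (if mat n A ! q then 2 else 1)"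
      by (simp add: word_tape_inp_mat) (simp add: word_tape_def flip: of_nat_mult)
    then show "step arc_tm (g q) = g (Suc q)"
      using q by (auto simp: g_def step_simps take_Suc_conv_app_nth algebra_simps)
  qed
  also have "runs arc_tm 1 (g (n * n)) (h 0)"
  proof (intro runs_step)
    have "word_tape (inp n A) (int n + 1 + int (n * n)) = 0"
      by (simp add: word_tape_eq_0 length_inp)
    then show "step arc_tm (g (n * n)) = h 0"
      by (simp add: g_def h_def step_simps header_def del: of_nat_mult)
  qed
  also have "runs arc_tm (n * n * 1) (h 0) (h (n * n))"
  proof (intro runs_loop runs_step)
    fix q assume "q < n * n"
    then have "word_tape (mat n A) (int (n * n) - 1 - int q) \<noteq> 0"
      by (simp add: word_tape_eq_0 del: of_nat_mult)
    then show "step arc_tm (h q) = h (Suc q)"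
      by (simp add: h_def step_simps algebra_simps del: of_nat_mult)
  qed
  also have "runs arc_tm 1 (h (n * n)) (cfg 4 (int n + 1) header 0 (int n - 1) (int n - 1) 0 0 0)"
  proof (intro runs_step)
    have "word_tape (mat n A) (- 1) = 0"
      by (simp add: word_tape_eq_0)
    then show "step arc_tm (h (n * n)) = cfg 4 (int n + 1) header 0 (int n - 1) (int n - 1) 0 0 0"
      by (simp add: h_def step_simps algebra_simps del: of_nat_mult)
  qed
  finally show ?thesis by (rule runs_mono) (simp add: algebra_simps)
qed

lemma rewind_counters:
  "runs arc_tm n (cfg 4 (int n + 1) header 0 (int n - 1) (int n - 1) 0 0 0)
     (cfg 4 (int n + 1) header 0 (- 1) (- 1) 0 0 0)"
proof -
  define f where "f m = cfg 4 (int n + 1) header 0 (int n - 1 - int m) (int n - 1 - int m) 0 0 0" for m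
  have "runs arc_tm (n * 1) (f 0) (f n)"
  proof (intro runs_loop runs_step)
    fix m assume "m < n"
    then have "word_tape (replicate n True) (int n - 1 - int m) \<noteq> 0"
      by (simp add: word_tape_replicate)
    then show "step arc_tm (f m) = f (Suc m)"
      by (simp add: f_def step_simps algebra_simps)
  qed
  then show ?thesis by (simp add: f_def)
qed

lemma reach_finish:
  obtains P Q L J a b d where
  "runs arc_tm (n * (n * (3 * n * n + 4 * n + 5) + (n + 2)) + 2)
     (cfg 4 (int n + 1) header 0 (- 1) (- 1) 0 0 0)
     (12, [P, tape_at (header @ grid n block n) (int (length (header @ grid n block n)) - 1), Q, L, J, a, b, d])"
proof (cases "n = 0")
  case True
  \<comment> \<open>For n = 0 tape 4 is blank, so states 5 and 6 would alternate forever; state 4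
    prevents this by testing tape 0 for the empty matrix.\<close>
  then have u: "word_tape (replicate n True) (- 1) = 0" "word_tape (inp n A) (int n + 1) = 0"
    and w: "grid n block n = []"
    by (simp_all add: word_tape_eq_0 length_inp)
  have "\<exists>P Q L J a b d. step arc_tm (cfg 4 (int n + 1) header 0 (- 1) (- 1) 0 0 0) =
     (12, [P, tape_at (header @ grid n block n) (int (length (header @ grid n block n)) - 1), Q, L, J, a, b, d])"
    unfolding w using u by (simp add: step_simps)
  then obtain P Q L J a b d where
    "step arc_tm (cfg 4 (int n + 1) header 0 (- 1) (- 1) 0 0 0) =
     (12, [P, tape_at (header @ grid n block n) (int (length (header @ grid n block n)) - 1), Q, L, J, a, b, d])"
    by blast
  from runs_step[OF this] show thesis
    by (intro that[of P Q L J a b d]) (elim runs_mono, simp)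
next
  case False
  let ?w = "header @ grid n block n"
  have un: "word_tape (replicate n True) (- 1) = 0" "word_tape (replicate n True) 0 \<noteq> 0"
    using False by (auto simp: word_tape_eq_0)
  have "word_tape (inp n A) (int n + 1) \<noteq> 0"
    using False by (simp add: word_tape_eq_0 length_inp mult_le_0_iff)
  then have "runs arc_tm 1 (cfg 4 (int n + 1) header 0 (- 1) (- 1) 0 0 0) (outer 0 0 header)"
    using un by (intro runs_step) (simp add: outer_def step_simps pos_def)
  also note outer_grid
  finally have 1: "runs arc_tm (1 + n * (n * (3 * n * n + 4 * n + 5) + (n + 2)))
    (cfg 4 (int n + 1) header 0 (- 1) (- 1) 0 0 0) (outer n 0 ?w)" .
  \<comment> \<open>After the last row j is 0 again, so tape 4 is not blank and state 5 gets to see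
    the blank behind the matrix on tape 0.\<close>
  have "word_tape (inp n A) (int n + 1 + int n * int n) = 0"
    by (simp add: word_tape_eq_0 length_inp)
  then have "\<exists>P Q L J a b d. step arc_tm (outer n 0 ?w) =
     (12, [P, tape_at ?w (int (length ?w) - 1), Q, L, J, a, b, d])"
    using un by (simp add: outer_def step_simps pos_def)
  then obtain P Q L J a b d where
    "step arc_tm (outer n 0 ?w) = (12, [P, tape_at ?w (int (length ?w) - 1), Q, L, J, a, b, d])"
    by blast
  from runs_trans[OF 1 runs_step[OF this]] show thesis
    by (intro that[of P Q L J a b d]) (elim runs_mono, simp)
qed

lemma arc_tm_computes:
  "computes_within arc_tm (inp n A) (header @ grid n block n)
     (n * (n * (3 * n * n + 4 * n + 5) + (n + 2)) + 2 * n * n + 3 * n + 7 + length (header @ grid n block n))"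
proof -
  let ?w = "header @ grid n block n"
  obtain P Q L J a b d where 
    "runs arc_tm (n * (n * (3 * n * n + 4 * n + 5) + (n + 2)) + 2)
     (cfg 4 (int n + 1) header 0 (- 1) (- 1) 0 0 0)
     (12, [P, tape_at ?w (int (length ?w) - 1), Q, L, J, a, b, d])"
    by (rule reach_finish)
  note * = runs_trans[OF runs_trans[OF start rewind_counters] this]
  obtain ts where ts: "runs arc_tm (length ?w + 1)
     (12, [P, tape_at ?w (int (length ?w) - 1), Q, L, J, a, b, d]) (13, ts)" "ts ! 1 = word_tape ?w"
    using finish by blast
  have "runs arc_tm
    (n * (n * (3 * n * n + 4 * n + 5) + (n + 2)) + 2 * n * n + 3 * n + 7 + length ?w)
    (init_config arc_tm (inp n A)) (13, ts)"
    by (rule runs_mono[OF runs_trans[OF * ts(1)]]) simp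
  with ts(2) show ?thesis
    unfolding computes_within_def runs_def by (auto simp: arc_tm_def)
qed

end

section \<open>The output as the encoding of the arc graph\<close>

lemma concat_map_if: "concat (map (\<lambda>x. if P x then f x else []) xs) = concat (map f (filter P xs))"
  by (induction xs) auto

text \<open>Skipping the cells where \<open>P\<close> fails filters the row-major enumeration of all
  cells, which is how \<open>arcs\<close> is defined.\<close>

lemma grid_if:
  "grid n (\<lambda>i j. if P i j then f i j else []) n =
     concat (map (\<lambda>(i, j). f i j) (filter (\<lambda>(i, j). P i j) (List.product [0..<n] [0..<n])))"
proof -
  have product: "concat (map (\<lambda>i. concat (map (g i) ys)) xs) =
    concat (map (\<lambda>(i, j). g i j) (List.product xs ys))" for g :: "nat \<Rightarrow> nat \<Rightarrow> 'a list" and xs ys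
    by (induction xs) (simp_all add: o_def)
  have "(\<lambda>(i, j). if P i j then f i j else []) =
    (\<lambda>e. if (case e of (i, j) \<Rightarrow> P i j) then (case e of (i, j) \<Rightarrow> f i j) else [])"
    by auto
  then show ?thesis
    unfolding grid_def line_def product by (simp only: concat_map_if)
qed

lemma computes_within_mono:
  "computes_within M v w T \<Longrightarrow> T \<le> U \<Longrightarrow> computes_within M v w U"
  unfolding computes_within_def using le_trans by blast

lemma encode_graph_eq_inp: "encode_graph G = inp (order G) (\<lambda>i j. {i, j} \<in> edges G)"
  by (simp add: encode_graph_def inp_def mat_def)

context
  fixes G :: graph and A
  defines "A \<equiv> \<lambda>i j. {i, j} \<in> edges G"
begin

interpretation adjacency_matrix "order G" A .

lemma arcs_eq: "arcs G = filter (\<lambda>(i, j). A i j) (List.product [0..<order G] [0..<order G])"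
  by (simp add: arcs_def A_def)

lemma header_eq: "header = replicate (length (arcs G)) True @ [False]"
proof -
  have "filter id (map P xs) = concat (map (\<lambda>j. if P j then [True] else []) xs)"
    for P :: "nat \<Rightarrow> bool" and xs
    by (induction xs) auto
  then have "filter id (mat (order G) A) = grid (order G) (\<lambda>i j. if A i j then [True] else []) (order G)"
    by (simp add: mat_def grid_def line_def filter_concat o_def)
  moreover have "concat (map (\<lambda>(i, j). [True]) xs) = replicate (length xs) True"
    for xs :: "(nat \<times> nat) list"
    by (induction xs) auto
  ultimately show ?thesis
    unfolding header_def grid_if arcs_eq by simp
qed

lemma grid_block_eq:
  "grid (order G) block (order G) = 
     concat (map (\<lambda>a. map (\<lambda>b. {a, b} \<in> edges (arc_graph G)) [0..<length (arcs G)]) [0..<length (arcs G)])"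
proof -
  let ?n = "order G" and ?N = "length (arcs G)"
  have "grid ?n block ?n = concat (map (\<lambda>(i, j). grid ?n (cell i j) ?n) (arcs G))"
    unfolding block_def[abs_def] grid_if arcs_eq ..
  also have "(\<lambda>(i, j). grid ?n (cell i j) ?n) = (\<lambda>e. map (\<lambda>f. e \<noteq> f \<and> \<not> consecutive e f) (arcs G))"
  proof (rule ext, clarify)
    fix i j
    have "bit i j k l \<longleftrightarrow> (i, j) \<noteq> (k, l) \<and> \<not> consecutive (i, j) (k, l)" for k l
      by (auto simp: bit_def consecutive_def)
    then have "grid ?n (cell i j) ?n =
      concat (map (\<lambda>(k, l). [(i, j) \<noteq> (k, l) \<and> \<not> consecutive (i, j) (k, l)]) (arcs G))"
      unfolding cell_def[abs_def] grid_if arcs_eq by simp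
    moreover have singles: "concat (map (\<lambda>(k, l). [g (k, l)]) xs) = map g xs"
      for g :: "nat \<times> nat \<Rightarrow> bool" and xs
      by (induction xs) auto
    ultimately show "grid ?n (cell i j) ?n = map (\<lambda>f. (i, j) \<noteq> f \<and> \<not> consecutive (i, j) f) (arcs G)"
      using singles[of "\<lambda>f. (i, j) \<noteq> f \<and> \<not> consecutive (i, j) f"] by (simp only:)
  qed
  also have "concat (map (\<lambda>e. map (\<lambda>f. e \<noteq> f \<and> \<not> consecutive e f) (arcs G)) (arcs G)) =
    concat (map (\<lambda>a. map (\<lambda>b. arcs G ! a \<noteq> arcs G ! b \<and> \<not> consecutive (arcs G ! a) (arcs G ! b)) [0..<?N]) [0..<?N])"
    by (subst (1 2) map_nth[of "arcs G", symmetric]) (simp only: map_map o_def)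
  \<comment> \<open>The list of arcs is distinct, so comparing arcs is the same as comparing their
    indices, the vertices of the arc graph.\<close>
  also have "\<dots> = concat (map (\<lambda>a. map (\<lambda>b. {a, b} \<in> edges (arc_graph G)) [0..<?N]) [0..<?N])"
    by (intro arg_cong[where f = concat] map_cong refl)
      (auto simp: edges_arc_graph_iff nth_eq_iff_index_eq[OF distinct_arcs])
  finally show ?thesis .
qed

lemma encode_arc_graph: "encode_graph (arc_graph G) = header @ grid (order G) block (order G)"
  unfolding header_eq grid_block_eq by (simp add: encode_graph_def)

lemma arc_tm_arc_graph:
  "computes_within arc_tm (encode_graph G) (encode_graph (arc_graph G))
     (poly (monom 30 2) (length (encode_graph G)))"
proof -
  define n where "n = order G"
  define N where "N = length (arcs G)"
  define x where "x = length (encode_graph G)"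
  have x: "x = n + 1 + n * n"
    by (simp add: x_def n_def encode_graph_eq_inp length_inp)
  have "N \<le> length (List.product [0..<n] [0..<n])"
    unfolding N_def n_def arcs_def by (rule length_filter_le)
  then have N: "N \<le> x" by (simp add: x)
  have len: "length (encode_graph (arc_graph G)) = N + 1 + N * N"
    by (simp add: encode_graph_eq_inp length_inp N_def)
  \<comment> \<open>Both sides are quartic in n, and the inequality holds coefficient by
    coefficient. With the three squares for the output length the total is 28, below the factor
    30.\<close>
  have "n * (n * (3 * n * n + 4 * n + 5) + (n + 2)) + 2 * n * n + 3 * n + 7 \<le> 25 * (x * x)"
    unfolding x by (simp add: algebra_simps)
  moreover have "N + 1 + N * N \<le> x * x + x * x + x * x"
  proof (intro add_mono)
    have "1 \<le> x" by (simp add: x)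
    then have "x * 1 \<le> x * x" by (rule mult_le_mono2)
    then show "N \<le> x * x" "1 \<le> x * x" using N \<open>1 \<le> x\<close> by linarith+
    show "N * N \<le> x * x" by (intro mult_le_mono N)
  qed
  ultimately have "n * (n * (3 * n * n + 4 * n + 5) + (n + 2)) + 2 * n * n + 3 * n + 7 +
      length (encode_graph (arc_graph G)) \<le> poly (monom 30 2) x"
    unfolding len by (simp add: poly_monom power2_eq_square)
  moreover have "computes_within arc_tm (encode_graph G) (encode_graph (arc_graph G))
    (n * (n * (3 * n * n + 4 * n + 5) + (n + 2)) + 2 * n * n + 3 * n + 7 +
      length (encode_graph (arc_graph G)))"
    using arc_tm_computes
    unfolding encode_arc_graph encode_graph_eq_inp[of G] A_def n_def .
  ultimately show ?thesis
    unfolding x_def by (rule computes_within_mono[rotated])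
qed

end

section \<open>The reduction\<close>

lemma poly_time_arc_graph: "poly_time_graph_map arc_graph"
  unfolding poly_time_graph_map_def
  using is_graph_arc_graph tm_wf_arc_tm arc_tm_arc_graph by blast

theorem theorem4p7:
  fixes \<Sigma> :: "'a set" and k1 k2 :: nat
  assumes "finite \<Sigma>" and "card \<Sigma> \<ge> 2"
  shows "poly_time_reducible (chromatic_problem (mid_binom k1) k2)
           (IC \<Sigma> (real k1) (log (real (card \<Sigma>)) (log 2 (real k2))))"
proof -
  have "\<Sigma> \<noteq> {}" using assms(2) by auto
  then have "\<forall>G\<in>fst (chromatic_problem (mid_binom k1) k2).
      arc_graph G \<in> fst (IC \<Sigma> (real k1) (log (real (card \<Sigma>)) (log 2 (real k2))))"
    using arc_graph_yes assms(1) by (auto simp: chromatic_problem_def IC_def is_graph_arc_graph)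
  moreover have "\<forall>G\<in>snd (chromatic_problem (mid_binom k1) k2).
      arc_graph G \<in> snd (IC \<Sigma> (real k1) (log (real (card \<Sigma>)) (log 2 (real k2))))"
    using arc_graph_no assms by (auto simp: chromatic_problem_def IC_def is_graph_arc_graph)
  ultimately show ?thesis
    unfolding poly_time_reducible_def using poly_time_arc_graph by blast
qed

end
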